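(* Let $\phi:\mathbb{R}^{n-1}\to\mathbb{R}$ be a convex function of class $\mathscr{C}^1$ satisfying $$\liminf_{|x|\to+\infty}\frac{\phi(x)}{|x|}>0.$$ Then the epigraph $E=\{(x,y)\in\mathbb{R}^{n-1}\times\mathbb{R}: y\ge\phi(x)\}$ has bounded convex exhaustion hulls (BCEH) if and only if $$\lim_{|x|\to\infty}|x|\left(1-\frac{\phi(x)}{x\cdot\nabla\phi(x)}\right)=+\infty.$$
   Context: A closed convex set $E\subset\mathbb{R}^n$ has bounded convex exhaustion hulls (BCEH) if for every compact convex set $K\subset\mathbb{R}^n$ the set $h(E,K)=\mathrm{Conv}(E\cup K)\setminus E$ is bounded, where $\mathrm{Conv}$ denotes the convex hull. $x\cdot\nabla\phi(x)$ is the Euclidean inner product of $x$ and the gradient of $\phi$ at $x$ (it is positive for all sufficiently large $|x|$ under the stated hypotheses). *)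

theory Defs
  imports "HOL-Analysis.Analysis"
begin

definition bceh :: "'a::euclidean_space set \<Rightarrow> bool" where
  "bceh E \<longleftrightarrow> closed E \<and> convex E \<and>
     (\<forall>K. compact K \<and> convex K \<longrightarrow> bounded (convex hull (E \<union> K) - E))"

(* Unspecified at points where f is not differentiable. *)
definition gradient :: "('a::euclidean_space \<Rightarrow> real) \<Rightarrow> 'a \<Rightarrow> 'a" where
  "gradient f x = (THE D. GDERIV f x :> D)"

lemma gradient_eqI:
  assumes "GDERIV f x :> D"
  shows "gradient f x = D"
  unfolding gradient_def
proof (rule the_equality)
  show "D' = D" if "GDERIV f x :> D'" for D'
  proof -
    have "(\<lambda>h. h \<bullet> D') = (\<lambda>h. h \<bullet> D)"
      using that assms unfolding gderiv_def by (rule has_derivative_unique)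
    then show ?thesis
      by (metis vector_eq_ldot)
  qed
qed (fact assms)

definition class_C1 :: "('a::euclidean_space \<Rightarrow> real) \<Rightarrow> bool" where
  "class_C1 f \<longleftrightarrow> (\<forall>x. f differentiable (at x)) \<and> continuous_on UNIV (gradient f)"

end

theory Submission
  imports Defs
begin

text \<open>
  Both sides of the equivalence say that tangent hyperplanes with a far-away point of contact pass
  below any prescribed compact set \<open>K\<close>.

  For the convex hulls: the half-space above the tangent hyperplane at \<open>x\<close> is convex and contains
  the epigraph \<open>E\<close>. If it contains \<open>K\<close> too, then the hull of \<open>E \<union> K\<close> gains no point over \<open>x\<close>. If
  instead some \<open>k \<in> K\<close> lies strictly below the hyperplane, then the open segment from \<open>k\<close> to
  \<open>(x, \<phi> x)\<close> lies strictly below it as well, so that it belongs to the hull but not to \<open>E\<close>, and it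
  reaches as far out as \<open>x\<close> does. See \<open>bceh_epigraph_iff_hyperplanes_escape\<close>.

  For the limit: over the ray from the origin through \<open>x\<close>, the tangent hyperplane at \<open>x\<close> restricts
  to a line, whose zero lies at distance \<open>|x| (1 - \<phi> x / (x \<bullet> \<nabla>\<phi> x))\<close> from the origin. Testing with
  the balls \<open>K = {|a| \<le> M} \<times> {0}\<close> shows that this distance tends to infinity when the hyperplanes
  escape. The converse has to exclude hyperplanes that are steep across the ray, and this is the
  main point: if the hyperplane at \<open>x\<close> passes above a point of \<open>K\<close>, where \<open>K\<close> has radius \<open>R\<close>
  about the origin, then at the point of norm \<open>2 R\<close> in the direction of \<open>\<nabla>\<phi> x\<close> its height is at least
  \<open>R |\<nabla>\<phi> x| - R\<close>. Since it stays below \<open>\<phi>\<close>, which is bounded on that ball, \<open>\<nabla>\<phi> x\<close> is bounded. Its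
  depth \<open>x \<bullet> \<nabla>\<phi> x - \<phi> x\<close> under the origin is then bounded too, and as linear growth of \<open>\<phi>\<close> bounds
  the radial slope from below, the zero stays within a bounded distance of the origin. See
  \<open>hyperplanes_escape_iff_zero_distance\<close>.

  The hyperplanes enter only as supports of \<open>\<phi>\<close>, so the argument is given for an arbitrary choice
  of subgradients; the gradient of a convex function is one.
\<close>

section \<open>Supporting hyperplanes of a convex function\<close>

definition subgradient_field :: "('a::euclidean_space \<Rightarrow> real) \<Rightarrow> ('a \<Rightarrow> 'a) \<Rightarrow> bool" where
  "subgradient_field f g \<longleftrightarrow> (\<forall>x z. f x + (z - x) \<bullet> g x \<le> f z)"

lemma subgradient_fieldD: "subgradient_field f g \<Longrightarrow> f x + (z - x) \<bullet> g x \<le> f z"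
  unfolding subgradient_field_def by blast

lemma differentiable_imp_GDERIV_gradient:
  fixes f :: "'a::euclidean_space \<Rightarrow> real"
  assumes "f differentiable (at x)"
  shows "GDERIV f x :> gradient f x"
proof -
  obtain f' where f': "(f has_derivative f') (at x)"
    using assms unfolding differentiable_def by blast
  then have lin: "linear f'"
    by (rule has_derivative_linear)
  have "f' h = h \<bullet> adjoint f' 1" for h
    using adjoint_works[OF lin, of h 1] by simp
  then have "f' = (\<lambda>h. h \<bullet> adjoint f' 1)"
    by (rule ext)
  then have "GDERIV f x :> adjoint f' 1"
    using f' unfolding gderiv_def by simp
  then show ?thesis
    using gradient_eqI by metis
qed

lemma convex_on_above_tangent_hyperplane:
  fixes f :: "'a::euclidean_space \<Rightarrow> real"
  assumes f: "convex_on UNIV f" and g: "GDERIV f x :> g"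
  shows "f x + (z - x) \<bullet> g \<le> f z"
proof -
  define p where "p t = x + t *\<^sub>R (z - x)" for t :: real
  have conv: "convex_on UNIV (\<lambda>t. f (p t))"
  proof (rule convex_onI)
    fix t a b :: real
    assume t: "0 < t" "t < 1"
    have "p ((1 - t) *\<^sub>R a + t *\<^sub>R b) = (1 - t) *\<^sub>R p a + t *\<^sub>R p b"
      unfolding p_def by (simp add: algebra_simps)
    then show "f (p ((1 - t) *\<^sub>R a + t *\<^sub>R b)) \<le> (1 - t) * f (p a) + t * f (p b)"
      using convex_onD[OF f, of t "p a" "p b"] t by simp
  qed simp
  have p': "(p has_derivative (\<lambda>h. h *\<^sub>R (z - x))) (at 0)"
    unfolding p_def by (auto intro!: derivative_eq_intros)
  have "(f has_derivative (\<lambda>h. h \<bullet> g)) (at (p 0))"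
    using g unfolding gderiv_def p_def by simp
  then have "((\<lambda>t. f (p t)) has_derivative (\<lambda>h. h *\<^sub>R (z - x) \<bullet> g)) (at 0)"
    using has_derivative_compose[OF p'] by blast
  then have "((\<lambda>t. f (p t)) has_field_derivative (z - x) \<bullet> g) (at 0)"
    unfolding has_field_derivative_def by (simp add: mult_commute_abs)
  then have "((z - x) \<bullet> g) * (1 - 0) \<le> f (p 1) - f (p 0)"
    using conv by (intro convex_on_imp_above_tangent[where A = UNIV]) auto
  then show ?thesis
    by (simp add: p_def)
qed

lemma subgradient_field_gradient:
  assumes "convex_on UNIV f" and "class_C1 f"
  shows "subgradient_field f (gradient f)"
  using assms convex_on_above_tangent_hyperplane differentiable_imp_GDERIV_gradient
  unfolding subgradient_field_def class_C1_def by blast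

text \<open>The hyperplane at \<open>x\<close> has radial slope at least \<open>(f x - f 0) / |x|\<close>, because it lies below
  \<open>f\<close> at the origin; linear growth of \<open>f\<close> therefore passes on to the radial slopes.\<close>

lemma radial_slope_bounded_below:
  fixes f :: "'a::euclidean_space \<Rightarrow> real"
  assumes g: "subgradient_field f g"
    and growth: "Liminf at_infinity (\<lambda>x. ereal (f x / norm x)) > 0"
  obtains c where "c > 0" "\<forall>\<^sub>F x in at_infinity. 0 < norm x \<and> c * norm x \<le> x \<bullet> g x"
proof -
  obtain e where e: "0 < ereal e" "ereal e < Liminf at_infinity (\<lambda>x. ereal (f x / norm x))"
    using ereal_dense2[OF growth] by auto
  have "\<forall>\<^sub>F x in at_infinity. e < f x / norm x"
    using less_LiminfD[OF e(2)] by simp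
  moreover have "\<forall>\<^sub>F x::'a in at_infinity. max 1 (2 * f 0 / e) \<le> norm x"
    unfolding eventually_at_infinity by blast
  ultimately have "\<forall>\<^sub>F x in at_infinity. 0 < norm x \<and> e / 2 * norm x \<le> x \<bullet> g x"
  proof eventually_elim
    case (elim x)
    then have "0 < norm x"
      by linarith
    then have "e * norm x < f x"
      using elim by (simp only: pos_less_divide_eq)
    moreover have "f 0 \<le> e / 2 * norm x"
      using elim e by (simp add: field_simps)
    moreover note \<open>0 < norm x\<close>
    moreover have "f x - f 0 \<le> x \<bullet> g x"
      using subgradient_fieldD[OF g, of x 0] by (simp add: inner_diff_left)
    ultimately show ?case
      by simp
  qed
  then show ?thesis
    using that[of "e / 2"] e by simp
qed

definition hyperplanes_escape :: "('a::euclidean_space \<Rightarrow> real) \<Rightarrow> ('a \<Rightarrow> 'a) \<Rightarrow> bool" where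
  "hyperplanes_escape f g \<longleftrightarrow>
     (\<forall>K. compact K \<longrightarrow> (\<forall>\<^sub>F x in at_infinity. \<forall>(a, b)\<in>K. f x + (a - x) \<bullet> g x \<le> b))"

section \<open>Convex hulls and supporting hyperplanes\<close>

lemma convex_above_hyperplane:
  fixes g x :: "'a::euclidean_space"
  shows "convex {(a, b). c + (a - x) \<bullet> g \<le> b}"
proof -
  have "{(a, b). c + (a - x) \<bullet> g \<le> b} = {p. c - x \<bullet> g \<le> (- g, 1::real) \<bullet> p}"
    by (auto simp: inner_diff_left inner_commute algebra_simps)
  then show ?thesis
    by (simp only: convex_halfspace_ge)
qed

lemma closed_epigraph:
  fixes f :: "'a::topological_space \<Rightarrow> real"
  assumes "continuous_on UNIV f"
  shows "closed (epigraph UNIV f)"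
  unfolding epigraph_def
  by (auto intro!: closed_Collect_le continuous_intros continuous_on_compose2[OF assms])

lemma continuous_on_compact_abs_bounded:
  fixes f :: "'a::topological_space \<Rightarrow> real"
  assumes "compact S" and "continuous_on S f"
  obtains B where "\<And>x. x \<in> S \<Longrightarrow> \<bar>f x\<bar> \<le> B"
proof -
  have "bounded (f ` S)"
    using assms by (intro compact_imp_bounded compact_continuous_image)
  then show ?thesis
    using that by (auto simp: bounded_iff)
qed

text \<open>Over the far-away points the hull adds nothing. Over the remaining ball it is bounded above by
  \<open>f\<close>, outside \<open>E\<close>, and bounded below by a translate of one fixed supporting hyperplane.\<close>

lemma hyperplanes_escape_imp_bceh:
  fixes f :: "'a::euclidean_space \<Rightarrow> real"
  assumes f: "convex_on UNIV f" and g: "subgradient_field f g"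
    and esc: "hyperplanes_escape f g"
  shows "bceh (epigraph UNIV f)"
  unfolding bceh_def
proof (intro conjI allI impI)
  have cont: "continuous_on UNIV f"
    using convex_on_continuous[OF _ f] by simp
  then show "closed (epigraph UNIV f)"
    by (rule closed_epigraph)
  show "convex (epigraph UNIV f)"
    using f by (rule convex_epigraphI)
  fix K :: "('a \<times> real) set"
  assume "compact K \<and> convex K"
  then have "compact K" ..
  let ?H = "convex hull (epigraph UNIV f \<union> K)"
  have above: "c + (a - x) \<bullet> g x \<le> b"
    if "(a, b) \<in> ?H" "c \<le> f x" "\<forall>(a, b)\<in>K. c + (a - x) \<bullet> g x \<le> b" for a b c x
  proof -
    have "c + (a - x) \<bullet> g x \<le> b" if "f a \<le> b" for a b
      using subgradient_fieldD[OF g, of x a] that \<open>c \<le> f x\<close> by linarith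
    then have "?H \<subseteq> {(a, b). c + (a - x) \<bullet> g x \<le> b}"
      using that(3) by (intro hull_minimal convex_above_hyperplane) (auto simp: epigraph_def)
    then show ?thesis
      using that(1) by blast
  qed
  obtain r where r: "\<And>x. r \<le> norm x \<Longrightarrow> \<forall>(a, b)\<in>K. f x + (a - x) \<bullet> g x \<le> b"
    using esc \<open>compact K\<close> unfolding hyperplanes_escape_def eventually_at_infinity by blast
  have "continuous_on K (\<lambda>p. snd p - fst p \<bullet> g 0)"
    by (intro continuous_intros)
  then obtain L where L: "\<And>p. p \<in> K \<Longrightarrow> \<bar>snd p - fst p \<bullet> g 0\<bar> \<le> L"
    using continuous_on_compact_abs_bounded[OF \<open>compact K\<close>] by blast
  obtain B where B: "\<And>x. norm x \<le> r \<Longrightarrow> \<bar>f x\<bar> \<le> B"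
    using continuous_on_compact_abs_bounded[OF compact_cball continuous_on_subset[OF cont subset_UNIV]]
    by (metis mem_cball_0)
  define c where "c = min (f 0) (- L)"
  have "?H - epigraph UNIV f \<subseteq> cball 0 r \<times> {c - r * norm (g 0)..B}"
  proof (rule subrelI)
    fix a b
    assume "(a, b) \<in> ?H - epigraph UNIV f"
    then have ab: "(a, b) \<in> ?H" "(a, b) \<notin> epigraph UNIV f"
      by auto
    have "\<not> r \<le> norm a"
      using above[OF ab(1) order_refl r, of a] ab(2) by (auto simp: mem_epigraph)
    then have ar: "norm a \<le> r"
      by simp
    have "c + a' \<bullet> g 0 \<le> b'" if "(a', b') \<in> K" for a' b'
      using L[OF that] by (auto simp: c_def)
    then have "c + (a - 0) \<bullet> g 0 \<le> b"
      by (intro above[OF ab(1)]) (auto simp: c_def)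
    moreover have "\<bar>a \<bullet> g 0\<bar> \<le> r * norm (g 0)"
      using Cauchy_Schwarz_ineq2[of a "g 0"] mult_right_mono[OF ar, of "norm (g 0)"] by simp
    ultimately have "c - r * norm (g 0) \<le> b"
      by simp
    moreover have "b \<le> B"
      using ab(2) B[OF ar] by (simp add: mem_epigraph)
    ultimately show "(a, b) \<in> cball 0 r \<times> {c - r * norm (g 0)..B}"
      using ar by simp
  qed
  then show "bounded (?H - epigraph UNIV f)"
    by (intro bounded_subset[OF bounded_Times[OF bounded_cball bounded_closed_interval]])
qed

text \<open>The midpoint of \<open>(x, f x)\<close> and a point of \<open>K\<close> below the hyperplane at \<open>x\<close> is added by the hull,
  and its norm is about half that of \<open>x\<close>.\<close>

lemma bceh_imp_hyperplanes_escape: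
  fixes f :: "'a::euclidean_space \<Rightarrow> real"
  assumes g: "subgradient_field f g" and bceh: "bceh (epigraph UNIV f)"
  shows "hyperplanes_escape f g"
  unfolding hyperplanes_escape_def
proof (intro allI impI)
  fix K :: "('a \<times> real) set"
  assume "compact K"
  let ?E = "epigraph UNIV f" and ?K = "convex hull K"
  have "compact ?K"
    using \<open>compact K\<close> by (rule compact_convex_hull)
  then have "bounded (convex hull (?E \<union> ?K) - ?E)"
    using bceh unfolding bceh_def by simp
  then obtain B where B: "\<And>p. p \<in> convex hull (?E \<union> ?K) - ?E \<Longrightarrow> norm p \<le> B"
    unfolding bounded_iff by blast
  obtain A where A: "\<And>p. p \<in> K \<Longrightarrow> norm p \<le> A"
    using compact_imp_bounded[OF \<open>compact K\<close>] unfolding bounded_iff by blast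
  have "\<forall>\<^sub>F x::'a in at_infinity. 2 * B + A + 1 \<le> norm x"
    unfolding eventually_at_infinity by blast
  then show "\<forall>\<^sub>F x in at_infinity. \<forall>(a, b)\<in>K. f x + (a - x) \<bullet> g x \<le> b"
  proof eventually_elim
    case (elim x)
    have False if k: "(a, b) \<in> K" and below: "b < f x + (a - x) \<bullet> g x" for a b
    proof -
      define p where "p = (1/2) *\<^sub>R (x, f x) + (1/2) *\<^sub>R (a, b)"
      have p_eq: "p = ((1/2) *\<^sub>R (x + a), (f x + b) / 2)"
        by (simp add: p_def algebra_simps)
      have "(x, f x) \<in> convex hull (?E \<union> ?K)" "(a, b) \<in> convex hull (?E \<union> ?K)"
        using k hull_inc[of _ K] hull_inc[of _ "?E \<union> ?K"] by (auto simp: mem_epigraph)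
      then have "p \<in> convex hull (?E \<union> ?K)"
        unfolding p_def by (intro convexD convex_convex_hull) auto
      moreover have "p \<notin> ?E"
      proof -
        have "(1/2) *\<^sub>R (x + a) - x = (1/2) *\<^sub>R (a - x)"
          by (simp add: algebra_simps flip: scaleR_add_left)
        then have "f x + (a - x) \<bullet> g x / 2 \<le> f ((1/2) *\<^sub>R (x + a))"
          using subgradient_fieldD[OF g, of x "(1/2) *\<^sub>R (x + a)"] by simp
        then show ?thesis
          using below by (simp add: p_eq mem_epigraph)
      qed
      ultimately have "norm p \<le> B"
        using B by blast
      then have "norm (x + a) / 2 \<le> B"
        using norm_fst_le[of "fst p" "snd p"] by (simp add: p_eq)
      moreover have "norm a \<le> A"
        using A[OF k] norm_fst_le[of a b] by linarith
      moreover have "norm x \<le> norm (x + a) + norm a"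
        using norm_triangle_ineq4[of "x + a" a] by simp
      ultimately show False
        using elim by linarith
    qed
    then show ?case
      by (auto simp: not_less[symmetric])
  qed
qed

lemma bceh_epigraph_iff_hyperplanes_escape:
  fixes f :: "'a::euclidean_space \<Rightarrow> real"
  assumes "convex_on UNIV f" and "subgradient_field f g"
  shows "bceh (epigraph UNIV f) \<longleftrightarrow> hyperplanes_escape f g"
  using assms hyperplanes_escape_imp_bceh bceh_imp_hyperplanes_escape by blast

section \<open>Zeros of the hyperplanes along rays\<close>

lemma zero_distance_ge_iff:
  fixes s m M :: real
  assumes "0 < n" and "0 < s"
  shows "M \<le> n * (1 - m / s) \<longleftrightarrow> M * s \<le> n * (s - m)"
  using assms by (simp add: field_simps)

lemma hyperplanes_escape_iff_zero_distance:
  fixes f :: "'a::euclidean_space \<Rightarrow> real"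
  assumes g: "subgradient_field f g" and cont: "continuous_on UNIV f"
    and growth: "Liminf at_infinity (\<lambda>x. ereal (f x / norm x)) > 0"
  shows "hyperplanes_escape f g \<longleftrightarrow>
    filterlim (\<lambda>x. norm x * (1 - f x / (x \<bullet> g x))) at_top at_infinity"
proof
  obtain c where "c > 0" and slope: "\<forall>\<^sub>F x in at_infinity. 0 < norm x \<and> c * norm x \<le> x \<bullet> g x"
    using radial_slope_bounded_below[OF g growth] by blast
  have slope_pos: "0 < x \<bullet> g x" if "0 < norm x \<and> c * norm x \<le> x \<bullet> g x" for x
    using that mult_pos_pos[OF \<open>c > 0\<close>, of "norm x"] by linarith
  {
    assume esc: "hyperplanes_escape f g"
    show "filterlim (\<lambda>x. norm x * (1 - f x / (x \<bullet> g x))) at_top at_infinity"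
      unfolding filterlim_at_top_ge[where c = 0]
    proof (intro allI impI)
      fix M :: real
      assume "0 \<le> M"
      have "compact (cball (0::'a) M \<times> {0::real})"
        by (intro compact_Times) auto
      then have "\<forall>\<^sub>F x in at_infinity. \<forall>(a, b)\<in>cball 0 M \<times> {0}. f x + (a - x) \<bullet> g x \<le> b"
        using esc unfolding hyperplanes_escape_def by blast
      then show "\<forall>\<^sub>F x in at_infinity. M \<le> norm x * (1 - f x / (x \<bullet> g x))"
        using slope
      proof eventually_elim
        case (elim x)
        have "(M / norm x) *\<^sub>R x \<in> cball 0 M"
          using \<open>0 \<le> M\<close> elim by simp
        then have "f x + ((M / norm x) *\<^sub>R x - x) \<bullet> g x \<le> 0"
          using elim by blast
        then have "M * (x \<bullet> g x) \<le> norm x * (x \<bullet> g x - f x)"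
          using elim by (simp add: inner_diff_left field_simps)
        then show ?case
          using elim slope_pos zero_distance_ge_iff by blast
      qed
    qed
  }
  {
    assume lim: "filterlim (\<lambda>x. norm x * (1 - f x / (x \<bullet> g x))) at_top at_infinity"
    show "hyperplanes_escape f g"
      unfolding hyperplanes_escape_def
    proof (intro allI impI)
      fix K :: "('a \<times> real) set"
      assume "compact K"
      then obtain R where "R > 0" and R: "\<And>p. p \<in> K \<Longrightarrow> norm p \<le> R"
        using compact_imp_bounded bounded_pos by metis
      obtain B where B: "\<And>z. norm z \<le> 2 * R \<Longrightarrow> \<bar>f z\<bar> \<le> B"
        using continuous_on_compact_abs_bounded[OF compact_cball continuous_on_subset[OF cont subset_UNIV]]
        by (metis mem_cball_0)
      \<comment> \<open>If the hyperplane at \<open>x\<close> passes above a point of \<open>K\<close>, then \<open>B + R\<close> bounds \<open>R |g x|\<close>, and hence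
        the depth of the hyperplane under the origin is less than \<open>R + (B + R)\<close>. A zero at distance at
        least \<open>(R + (B + R)) / c\<close> and a radial slope at least \<open>c\<close> contradict this.\<close>
      have "\<forall>\<^sub>F x in at_infinity. (R + (B + R)) / c \<le> norm x * (1 - f x / (x \<bullet> g x))"
        using lim unfolding filterlim_at_top by blast
      then show "\<forall>\<^sub>F x in at_infinity. \<forall>(a, b)\<in>K. f x + (a - x) \<bullet> g x \<le> b"
        using slope
      proof eventually_elim
        case (elim x)
        have "x \<bullet> g x > 0"
          using elim slope_pos by blast
        then have "g x \<noteq> 0"
          by auto
        have "0 \<le> R + (B + R)"
          using B[of 0] \<open>R > 0\<close> by simp
        then have "(R + (B + R)) / c * (c * norm x) \<le> (R + (B + R)) / c * (x \<bullet> g x)"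
          using elim \<open>c > 0\<close> by (intro mult_left_mono) auto
        also have "\<dots> \<le> norm x * (x \<bullet> g x - f x)"
          using elim \<open>x \<bullet> g x > 0\<close> zero_distance_ge_iff by blast
        finally have "norm x * (R + (B + R)) \<le> norm x * (x \<bullet> g x - f x)"
          using \<open>c > 0\<close> by (simp add: mult.commute)
        then have depth: "R + (B + R) \<le> x \<bullet> g x - f x"
          using elim by (simp only: mult_le_cancel_left_pos)
        have False if k: "(a, b) \<in> K" and below: "b < f x + (a - x) \<bullet> g x" for a b
        proof -
          have ab: "norm a \<le> R" "\<bar>b\<bar> \<le> R"
            using R[OF k] norm_fst_le[of a b] norm_snd_le[of b a] by auto
          have "a \<bullet> g x \<le> R * norm (g x)"
            using norm_cauchy_schwarz[of a "g x"] mult_right_mono[OF ab(1), of "norm (g x)"] by simp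
          then have depth_less: "x \<bullet> g x - f x < R + R * norm (g x)"
            using below ab(2) by (simp add: inner_diff_left)
          define z where "z = (2 * R / norm (g x)) *\<^sub>R g x"
          have "norm z = 2 * R"
            using \<open>R > 0\<close> \<open>g x \<noteq> 0\<close> by (simp add: z_def)
          then have "f z \<le> B"
            using B[of z] by simp
          moreover have "z \<bullet> g x = 2 * R * norm (g x)"
            using \<open>g x \<noteq> 0\<close> by (simp add: z_def dot_square_norm power2_eq_square)
          ultimately have "2 * R * norm (g x) - (x \<bullet> g x - f x) \<le> B"
            using subgradient_fieldD[OF g, of x z] by (simp add: inner_diff_left)
          then have "R * norm (g x) \<le> B + R"
            using depth_less by linarith
          then show False
            using depth depth_less by linarith
        qed
        then show ?case
          by (auto simp: not_less[symmetric])
      qed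
    qed
  }
qed

theorem proposition3p8:
  fixes \<phi> :: "real ^ 'n \<Rightarrow> real"
  assumes "convex_on UNIV \<phi>"
    and "class_C1 \<phi>"
    and "Liminf at_infinity (\<lambda>x. ereal (\<phi> x / norm x)) > 0"
  shows "bceh (epigraph UNIV \<phi>) \<longleftrightarrow>
    filterlim (\<lambda>x. norm x * (1 - \<phi> x / (x \<bullet> gradient \<phi> x))) at_top at_infinity"
proof -
  have "subgradient_field \<phi> (gradient \<phi>)"
    using assms by (intro subgradient_field_gradient)
  moreover have "continuous_on UNIV \<phi>"
    using convex_on_continuous[OF _ assms(1)] by simp
  ultimately show ?thesis
    using assms bceh_epigraph_iff_hyperplanes_escape hyperplanes_escape_iff_zero_distance by blast
qed

end
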